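(* Let $G$ be a nontrivial subgroup of $\mathbb{Q}$, let $S=G\cap\mathbb{Q}^+$, let $u\in\mathbb{N}\cup\{\omega\}$, let $v\in\mathbb{N}$, and let $A$ be a $u\times v$ matrix with rational entries that is weakly image partition regular over $S$. Then there exists a $u\times v$ matrix $C$ whose entries lie in the subgroup of $\mathbb{Q}$ generated by the entries of $A$ such that (1) $\{C\vec y:\vec y\in S^v\}\subseteq\{A\vec x:\vec x\in G^v\}$, and (2) whenever $S$ is finitely coloured, there exists $\vec x\in G^v$ such that the entries of $A\vec x$ are monochromatic and there is some $\vec y\in S^v$ with $C\vec y=A\vec x$.
   Context: $\mathbb{N}$ is the set of positive integers, $\omega=\{0,1,2,\dots\}$, $\mathbb{Q}^+=\{x\in\mathbb{Q}:x>0\}$; each $v\in\mathbb{N}$ is identified with $\{0,\dots,v-1\}$; a $u\times v$ matrix has rows indexed by $u$ and columns by $v$ and finitely many nonzero entries per row. Nontrivial means $\neq\{0\}$. A finite colouring is a function with finite range; "the entries of $A\vec x$ are monochromatic" includes that they lie in the coloured set $S$. $A$ is weakly image partition regular over $S$ if for every finite colouring of $S$ there is $\vec x\in G^v$ with the entries of $A\vec x$ in $S$ and monochromatic ($G$ is the group generated by $S$). *)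

theory Defs
  imports
    "HOL-Library.FuncSet"
    "HOL-Library.Extended_Nat"
    "HOL-Computational_Algebra.Group_Closure"
begin

(* A u x v matrix with u a positive integer or omega (the extended natural \<infinity>) is a function
   A :: nat \<Rightarrow> nat \<Rightarrow> rat of which only the values A i j with i \<in> row_inds u and j < v matter.
   Vectors are extensional functions, so that equality of vectors is equality of entries.
   As v is finite, the condition of finitely many nonzero entries per row is automatic. *)

definition row_inds :: "enat \<Rightarrow> nat set" where
  "row_inds u = {i. enat i < u}"

definition vecs :: "nat \<Rightarrow> rat set \<Rightarrow> (nat \<Rightarrow> rat) set" where
  "vecs v X = {..<v} \<rightarrow>\<^sub>E X"

definition mat_vec :: "enat \<Rightarrow> nat \<Rightarrow> (nat \<Rightarrow> nat \<Rightarrow> rat) \<Rightarrow> (nat \<Rightarrow> rat) \<Rightarrow> (nat \<Rightarrow> rat)" where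
  "mat_vec u v A x = (\<lambda>i\<in>row_inds u. \<Sum>j<v. A i j * x j)"

definition mat_entries :: "enat \<Rightarrow> nat \<Rightarrow> (nat \<Rightarrow> nat \<Rightarrow> rat) \<Rightarrow> rat set" where
  "mat_entries u v A = {A i j | i j. i \<in> row_inds u \<and> j < v}"

definition subgroup_rat :: "rat set \<Rightarrow> bool" where
  "subgroup_rat G \<longleftrightarrow> 0 \<in> G \<and> (\<forall>x\<in>G. \<forall>y\<in>G. x + y \<in> G) \<and> (\<forall>x\<in>G. - x \<in> G)"

definition finite_colouring :: "rat set \<Rightarrow> (rat \<Rightarrow> nat) \<Rightarrow> bool" where
  "finite_colouring S c \<longleftrightarrow> finite (c ` S)"

definition monochromatic_in :: "rat set \<Rightarrow> (rat \<Rightarrow> nat) \<Rightarrow> rat set \<Rightarrow> bool" where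
  "monochromatic_in S c E \<longleftrightarrow> E \<subseteq> S \<and> (\<exists>k. \<forall>e\<in>E. c e = k)"

definition weakly_image_partition_regular ::
  "rat set \<Rightarrow> enat \<Rightarrow> nat \<Rightarrow> (nat \<Rightarrow> nat \<Rightarrow> rat) \<Rightarrow> bool" where
  "weakly_image_partition_regular S u v A \<longleftrightarrow>
     (\<forall>c. finite_colouring S c \<longrightarrow>
        (\<exists>x\<in>vecs v (group_closure S). monochromatic_in S c (mat_vec u v A x ` row_inds u)))"

end

theory Submission
  imports Defs
begin

text \<open>
  Every vector with entries in \<open>G\<close> is obtained from a positive vector by multiplying entrywise by signs
  in \<open>{-1, 0, 1}\<close>. There are only finitely many sign patterns \<open>s\<close>, so if each of the
  matrices \<open>A diag(s)\<close> failed for some finite colouring, then the product of these colourings would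
  contradict the weak image partition regularity of \<open>A\<close>.
\<close>

text \<open>Weak image partition regularity yields vectors over the group generated by
  \<open>S\<close>; this carries them over to \<open>G\<close>.\<close>

lemma group_closure_subset_subgroup_rat:
  assumes "subgroup_rat G" and "S \<subseteq> G"
  shows "group_closure S \<subseteq> G"
proof
  fix x assume "x \<in> group_closure S"
  then show "x \<in> G"
  proof induction
    case base then show ?case using assms by (auto simp: subgroup_rat_def)
  next
    case (diff s t)
    have "- t \<in> G" using assms diff by (auto simp: subgroup_rat_def)
    then have "s + - t \<in> G" using assms diff unfolding subgroup_rat_def by blast
    then show ?case by simp
  qed
qed

lemma subgroup_rat_sign_mult:
  assumes "subgroup_rat G" and "y \<in> G" and "s \<in> {-1, 0, 1}"
  shows "s * y \<in> G"
  using assms by (auto simp: subgroup_rat_def)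

lemma subgroup_rat_ex_positive:
  assumes "subgroup_rat G" and "G \<noteq> {0}"
  obtains p where "p \<in> G" and "p > 0"
proof -
  obtain q where "q \<in> G" "q \<noteq> 0"
    using assms by (auto simp: subgroup_rat_def)
  moreover have "- q \<in> G" using assms \<open>q \<in> G\<close> by (auto simp: subgroup_rat_def)
  ultimately show thesis using that[of q] that[of "- q"] by (cases "q > 0") auto
qed

text \<open>Colour \<open>q\<close> by the tuple of its colours under all \<open>c i\<close>.
  Finitely many finite ranges allow only finitely many tuples, and equal tuples agree in every
  coordinate.\<close>

lemma finite_colouring_common_refinement:
  assumes "finite I" and "\<And>i. i \<in> I \<Longrightarrow> finite_colouring S (c i)"
  obtains d where "finite_colouring S d"
    and "\<And>i E. i \<in> I \<Longrightarrow> monochromatic_in S d E \<Longrightarrow> monochromatic_in S (c i) E"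
proof -
  define F where "F q = (\<lambda>i\<in>I. c i q)" for q
  have "F ` S \<subseteq> (\<Pi>\<^sub>E i\<in>I. c i ` S)"
    by (auto simp: F_def)
  moreover have "finite (\<Pi>\<^sub>E i\<in>I. c i ` S)"
    using assms by (intro finite_PiE) (auto simp: finite_colouring_def)
  ultimately have fin: "finite (F ` S)"
    by (rule finite_subset)
  \<comment> \<open>Colours are natural numbers, so the finitely many tuples are numbered
    injectively.\<close>
  then obtain h :: "(_ \<Rightarrow> nat) \<Rightarrow> nat" where h: "inj_on h (F ` S)"
    using finite_imp_inj_to_nat_seg by metis
  show thesis
  proof
    show "finite_colouring S (\<lambda>q. h (F q))"
      using finite_imageI[OF fin, of h] by (simp add: finite_colouring_def image_image)
  next
    fix i E
    assume i: "i \<in> I" and "monochromatic_in S (\<lambda>q. h (F q)) E"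
    then obtain k where E: "E \<subseteq> S" and k: "\<And>e. e \<in> E \<Longrightarrow> h (F e) = k"
      by (auto simp: monochromatic_in_def)
    have "c i e = c i e'" if "e \<in> E" "e' \<in> E" for e e'
    proof -
      \<comment> \<open>\<open>h\<close> is injective only on tuples of points of \<open>S\<close>,
        hence the appeal to \<open>E \<subseteq> S\<close>.\<close>
      have "F e = F e'"
        using inj_onD[OF h, of "F e" "F e'"] that E k by auto
      then have "F e i = F e' i" by simp
      then show ?thesis using i by (simp add: F_def)
    qed
    with E show "monochromatic_in S (c i) E"
      unfolding monochromatic_in_def by metis
  qed
qed

lemma vecs_sign_decomposition:
  assumes G: "subgroup_rat G" "G \<noteq> {0}" and x: "x \<in> vecs v G"
  obtains s y where "s \<in> vecs v {-1, 0, 1}" and "y \<in> vecs v (G \<inter> {q. q > 0})"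
    and "\<And>j. j < v \<Longrightarrow> x j = s j * y j"
proof -
  obtain p where p: "p \<in> G" "p > 0"
    using subgroup_rat_ex_positive[OF G] .
  have xG: "x j \<in> G" "- x j \<in> G" if "j < v" for j
    using x G that by (auto simp: vecs_def subgroup_rat_def)
  show thesis
  proof
    show "(\<lambda>j\<in>{..<v}. sgn (x j)) \<in> vecs v {-1, 0, 1}"
      by (auto simp: vecs_def sgn_if)
    \<comment> \<open>Absolute values stay in \<open>G\<close> by closure under negation. Where
      \<open>x j = 0\<close>, the sign 0 annihilates \<open>y j\<close>, so any positive element of
      \<open>G\<close> can fill the place; \<open>p\<close> does so.\<close>
    show "(\<lambda>j\<in>{..<v}. if x j = 0 then p else \<bar>x j\<bar>) \<in> vecs v (G \<inter> {q. q > 0})"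
      using p xG by (auto simp: vecs_def abs_if)
  qed (auto simp: sgn_mult_abs)
qed

text \<open>Absorbing the signs into the vector exhibits each image of \<open>A diag(s)\<close> as
  an image of \<open>A\<close>.\<close>

lemma mat_vec_scale_columns:
  "mat_vec u v (\<lambda>i j. A i j * s j) y = mat_vec u v A (\<lambda>j\<in>{..<v}. s j * y j)"
  unfolding mat_vec_def
  by (intro restrict_ext sum.cong) (auto simp: mult.assoc)

theorem theorem3p7:
  fixes G S :: "rat set" and u :: enat and v :: nat and A :: "nat \<Rightarrow> nat \<Rightarrow> rat"
  assumes "subgroup_rat G" and "G \<noteq> {0}"
    and "S = G \<inter> {q. q > 0}"
    and "u > 0" and "v > 0"
    and "weakly_image_partition_regular S u v A"
  shows "\<exists>C :: nat \<Rightarrow> nat \<Rightarrow> rat.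
           mat_entries u v C \<subseteq> group_closure (mat_entries u v A) \<and>
           {mat_vec u v C y | y. y \<in> vecs v S} \<subseteq> {mat_vec u v A x | x. x \<in> vecs v G} \<and>
           (\<forall>c. finite_colouring S c \<longrightarrow>
              (\<exists>x\<in>vecs v G. monochromatic_in S c (mat_vec u v A x ` row_inds u) \<and>
                 (\<exists>y\<in>vecs v S. mat_vec u v C y = mat_vec u v A x)))"
proof -
  define signs :: "(nat \<Rightarrow> rat) set" where "signs = vecs v {-1, 0, 1}"
  define C where "C s = (\<lambda>i j. A i j * s j)" for s :: "nat \<Rightarrow> rat"
  define good where "good s c \<longleftrightarrow>
    (\<exists>x\<in>vecs v G. monochromatic_in S c (mat_vec u v A x ` row_inds u) \<and>
       (\<exists>y\<in>vecs v S. mat_vec u v (C s) y = mat_vec u v A x))" for s c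
  have "finite signs"
    unfolding signs_def vecs_def by (intro finite_PiE) auto
  have entries: "mat_entries u v (C s) \<subseteq> group_closure (mat_entries u v A)"
    if "s \<in> signs" for s
  proof
    fix a assume "a \<in> mat_entries u v (C s)"
    then obtain i j where ij: "i \<in> row_inds u" "j < v" and a: "a = A i j * s j"
      by (auto simp: mat_entries_def C_def)
    have "A i j \<in> group_closure (mat_entries u v A)"
      using ij by (intro group_closure.base) (auto simp: mat_entries_def)
    moreover have "s j \<in> {-1, 0, 1}"
      using that ij by (auto simp: signs_def vecs_def)
    \<comment> \<open>The entry \<open>a\<close> is \<open>A i j\<close>, its negative or 0.\<close>
    ultimately show "a \<in> group_closure (mat_entries u v A)"
      using a by auto
  qed
  have image: "{mat_vec u v (C s) y | y. y \<in> vecs v S} \<subseteq> {mat_vec u v A x | x. x \<in> vecs v G}"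
    if "s \<in> signs" for s
  proof -
    have "(\<lambda>j\<in>{..<v}. s j * y j) \<in> vecs v G" if "y \<in> vecs v S" for y
      using that \<open>s \<in> signs\<close> assms(3) subgroup_rat_sign_mult[OF assms(1)]
      unfolding signs_def vecs_def by (intro restrict_PiE_iff[THEN iffD2]) blast
    then show ?thesis
      unfolding C_def mat_vec_scale_columns by blast
  qed
  have "\<exists>s\<in>signs. \<forall>c. finite_colouring S c \<longrightarrow> good s c"
  proof (rule ccontr)
    assume "\<not> ?thesis"
    \<comment> \<open>Choice: one bad colouring \<open>c s\<close> for each sign pattern
      \<open>s\<close>.\<close>
    then obtain c where c: "\<And>s. s \<in> signs \<Longrightarrow> finite_colouring S (c s) \<and> \<not> good s (c s)"
      by metis
    \<comment> \<open>The sign pattern of the vector \<open>x\<close> found below is not known in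
      advance, so \<open>d\<close> must refine all the bad colourings at once.\<close>
    obtain d where "finite_colouring S d"
      and d: "\<And>s E. s \<in> signs \<Longrightarrow> monochromatic_in S d E \<Longrightarrow> monochromatic_in S (c s) E"
      using finite_colouring_common_refinement[OF \<open>finite signs\<close>] c by metis
    then obtain x where x: "x \<in> vecs v (group_closure S)"
      and mono: "monochromatic_in S d (mat_vec u v A x ` row_inds u)"
      using assms(6) by (auto simp: weakly_image_partition_regular_def)
    have xG: "x \<in> vecs v G"
      using x PiE_mono[of "{..<v}" "\<lambda>_. group_closure S" "\<lambda>_. G"]
        group_closure_subset_subgroup_rat[OF assms(1), of S] assms(3)
      unfolding vecs_def by blast
    obtain s y where s: "s \<in> signs" and y: "y \<in> vecs v S"
      and xy: "\<And>j. j < v \<Longrightarrow> x j = s j * y j"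
      using vecs_sign_decomposition[OF assms(1,2) xG] unfolding signs_def assms(3) by metis
    have "mat_vec u v (C s) y = mat_vec u v A x"
      unfolding mat_vec_def C_def by (intro restrict_ext sum.cong) (auto simp: xy)
    \<comment> \<open>Monochromatic for \<open>d\<close> implies monochromatic for
      \<open>c s\<close> with \<open>s\<close> the pattern of this \<open>x\<close>, against the
      choice of \<open>c s\<close>.\<close>
    then have "good s (c s)"
      unfolding good_def using xG y d[OF s mono] by blast
    then show False using c[OF s] by blast
  qed
  then show ?thesis
    using entries image unfolding good_def by blast
qed

end
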